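(* Let $m,n\ge 1$ be integers and let $M$ be any matching of size $k$ in the complete bipartite graph $K_{m,n}$. Then the number $\tau_M(K_{m,n})$ of spanning trees of $K_{m,n}$ that contain every edge of $M$ is $$\tau_M(K_{m,n})=(m+n)^{k-1}(m+n-k)\,m^{n-k-1}n^{m-k-1}.$$
   Context: $K_{m,n}$ denotes the complete bipartite graph with parts of sizes $m$ and $n$. For a subgraph (or edge set) $H$ of a graph $G$, $\tau_H(G)$ denotes the number of spanning trees of $G$ containing all edges of $H$. *)

theory Defs
  imports Complex_Main
begin

text \<open>
  Finite simple undirected graphs, with edges as two-element vertex sets. The notion of tree in the
  AFP entry Graph_Theory is not suitable here: it excludes directed cycles only, so a symmetric
  digraph containing an edge $uv$ is never a tree there (because of the closed walk $u, v, u$).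
\<close>

record 'v ugraph =
  verts :: "'v set"
  edges :: "'v set set"

definition simple_graph :: "'v ugraph \<Rightarrow> bool" where
  "simple_graph G \<longleftrightarrow> finite (verts G) \<and> (\<forall>e\<in>edges G. e \<subseteq> verts G \<and> card e = 2)"

definition walk :: "'v ugraph \<Rightarrow> 'v list \<Rightarrow> bool" where
  "walk G vs \<longleftrightarrow> vs \<noteq> [] \<and> set vs \<subseteq> verts G \<and> successively (\<lambda>u v. {u, v} \<in> edges G) vs"

definition connected_graph :: "'v ugraph \<Rightarrow> bool" where
  "connected_graph G \<longleftrightarrow>
     verts G \<noteq> {} \<and> (\<forall>u\<in>verts G. \<forall>v\<in>verts G. \<exists>vs. walk G vs \<and> hd vs = u \<and> last vs = v)"

text \<open>A cycle is given by the list of its distinct vertices, the first one not being repeated.\<close>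

definition cycle :: "'v ugraph \<Rightarrow> 'v list \<Rightarrow> bool" where
  "cycle G vs \<longleftrightarrow> walk G vs \<and> distinct vs \<and> length vs \<ge> 3 \<and> {last vs, hd vs} \<in> edges G"

definition acyclic_graph :: "'v ugraph \<Rightarrow> bool" where
  "acyclic_graph G \<longleftrightarrow> (\<nexists>vs. cycle G vs)"

definition tree :: "'v ugraph \<Rightarrow> bool" where
  "tree G \<longleftrightarrow> simple_graph G \<and> connected_graph G \<and> acyclic_graph G"

definition spanning_tree :: "'v ugraph \<Rightarrow> 'v ugraph \<Rightarrow> bool" where
  "spanning_tree T G \<longleftrightarrow> tree T \<and> verts T = verts G \<and> edges T \<subseteq> edges G"

definition num_spanning_trees_containing :: "'v set set \<Rightarrow> 'v ugraph \<Rightarrow> nat" (\<open>\<tau>\<^bsub>_\<^esub>\<close>) where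
  "\<tau>\<^bsub>H\<^esub> G = card {T. spanning_tree T G \<and> H \<subseteq> edges T}"

definition matching :: "'v ugraph \<Rightarrow> 'v set set \<Rightarrow> bool" where
  "matching G M \<longleftrightarrow> M \<subseteq> edges G \<and> pairwise disjnt M"

definition complete_bipartite :: "nat \<Rightarrow> nat \<Rightarrow> 'v ugraph \<Rightarrow> bool" where
  "complete_bipartite m n G \<longleftrightarrow>
     (\<exists>A B. finite A \<and> finite B \<and> A \<inter> B = {} \<and> card A = m \<and> card B = n \<and>
            verts G = A \<union> B \<and> edges G = {{a, b} | a b. a \<in> A \<and> b \<in> B})"

end

theory Submission
  imports Defs "HOL-Library.Transitive_Closure_Table"
begin

text \<open>
  Let $F$ be a spanning forest of $K_{m,n}$ with parts $A$, $B$, and for a component $C$ of $F$ put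
  $a_C = |C \cap A|$, $b_C = |C \cap B|$ and $x_C = n a_C + m b_C$. We show that the number of
  spanning trees containing $F$ is
  $$\tau_F = \frac{1}{mn} \prod_C x_C \Bigl(1 - \sum_C \frac{a_C b_C}{x_C}\Bigr).$$
  If $F$ has $c$ components, every such tree has exactly $c - 1$ edges outside $F$, so
  $(c - 1) \tau_F = \sum_e \tau_{F + e}$, where $e$ runs over the edges joining two distinct
  components. This recurrence determines $\tau$ by induction on $c$, and the closed form satisfies
  it because merging two components adds their $a$, $b$ and $x$. For a matching of size $k$ the
  components are $k$ edges with $x_C = m + n$, then $m - k$ single vertices with $x_C = n$ and
  $n - k$ single vertices with $x_C = m$.
\<close>

section \<open>Connectivity and forests as edge sets\<close>

definition adj :: "'v set set \<Rightarrow> ('v \<times> 'v) set" where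
  "adj F = {(u, v). {u, v} \<in> F}"

definition comp_of :: "'v set set \<Rightarrow> 'v \<Rightarrow> 'v set" where
  "comp_of F u = {v. (u, v) \<in> (adj F)\<^sup>*}"

definition comps :: "'v set \<Rightarrow> 'v set set \<Rightarrow> 'v set set" where
  "comps V F = comp_of F ` V"

text \<open>A forest is an edge set in which every edge is a bridge; this also excludes loops.\<close>

definition forest :: "'v set set \<Rightarrow> bool" where
  "forest F \<longleftrightarrow> (\<forall>u v. {u, v} \<in> F \<longrightarrow> (u, v) \<notin> (adj (F - {{u, v}}))\<^sup>*)"

section \<open>Reachability classes and the effect of one new edge\<close>

lemma adj_rtrancl_mono: "F \<subseteq> F' \<Longrightarrow> (u, v) \<in> (adj F)\<^sup>* \<Longrightarrow> (u, v) \<in> (adj F')\<^sup>*"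
  by (rule subsetD[OF rtrancl_mono]) (auto simp: adj_def)

lemma adj_rtrancl_sym: "(u, v) \<in> (adj F)\<^sup>* \<Longrightarrow> (v, u) \<in> (adj F)\<^sup>*"
  by (rule symD[OF sym_rtrancl]) (auto simp: sym_def adj_def insert_commute)

lemma adj_insert: "adj (insert {u, v} F) = insert (u, v) (insert (v, u) (adj F))"
  by (auto simp: adj_def doubleton_eq_iff)

lemma comp_of_eq_iff: "comp_of F u = comp_of F v \<longleftrightarrow> (u, v) \<in> (adj F)\<^sup>*"
  unfolding comp_of_def by (auto intro: adj_rtrancl_sym rtrancl_trans)

lemma comp_of_self: "u \<in> comp_of F u"
  by (simp add: comp_of_def)

lemma comp_of_eqI: "v \<in> comp_of F u \<Longrightarrow> comp_of F v = comp_of F u"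
  using comp_of_eq_iff[of F u v] by (simp add: comp_of_def)

text \<open>A path through the new edge crosses between the classes of \<open>u\<close> and
  \<open>v\<close>, so only these two classes change. The formula stays correct when they already
  coincide.\<close>

lemma comp_of_insert:
  "comp_of (insert {u, v} F) w =
     (if w \<in> comp_of F u \<union> comp_of F v then comp_of F u \<union> comp_of F v else comp_of F w)"
  unfolding comp_of_def adj_insert rtrancl_insert
  by (auto intro: rtrancl_trans adj_rtrancl_sym)

lemma comp_of_subset:
  assumes "\<And>e. e \<in> F \<Longrightarrow> e \<subseteq> V" "u \<in> V"
  shows "comp_of F u \<subseteq> V"
proof
  fix v assume "v \<in> comp_of F u"
  then have "(u, v) \<in> (adj F)\<^sup>*" by (simp add: comp_of_def)
  then show "v \<in> V"
    by (induction rule: rtrancl_induct) (use assms in \<open>auto simp: adj_def\<close>)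
qed

lemma Union_comps:
  assumes "\<And>e. e \<in> F \<Longrightarrow> e \<subseteq> V"
  shows "\<Union> (comps V F) = V"
proof
  show "\<Union> (comps V F) \<subseteq> V" using comp_of_subset[OF assms] by (auto simp: comps_def)
  show "V \<subseteq> \<Union> (comps V F)" using comp_of_self[of _ F] by (auto simp: comps_def)
qed

lemma comps_disjoint: "C \<in> comps V F \<Longrightarrow> D \<in> comps V F \<Longrightarrow> C \<noteq> D \<Longrightarrow> C \<inter> D = {}"
  unfolding comps_def by (smt (verit) comp_of_eqI disjoint_iff image_iff)

lemma comps_nonempty: "C \<in> comps V F \<Longrightarrow> C \<noteq> {}"
  unfolding comps_def using comp_of_self[of _ F] by auto

lemma comps_insert:
  assumes "u \<in> V" "v \<in> V"
  shows "comps V (insert {u, v} F) =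
    insert (comp_of F u \<union> comp_of F v) (comps V F - {comp_of F u, comp_of F v})"
proof (intro equalityI subsetI)
  fix C assume "C \<in> comps V (insert {u, v} F)"
  then obtain w where w: "w \<in> V" "C = comp_of (insert {u, v} F) w" by (auto simp: comps_def)
  show "C \<in> insert (comp_of F u \<union> comp_of F v) (comps V F - {comp_of F u, comp_of F v})"
  proof (cases "w \<in> comp_of F u \<union> comp_of F v")
    case True then show ?thesis using w by (simp add: comp_of_insert)
  next
    case False
    then have "comp_of F w \<noteq> comp_of F u" "comp_of F w \<noteq> comp_of F v"
      using comp_of_self[of w F] by auto
    then show ?thesis using w False by (auto simp: comp_of_insert comps_def)
  qed
next
  fix C assume "C \<in> insert (comp_of F u \<union> comp_of F v) (comps V F - {comp_of F u, comp_of F v})"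
  then consider "C = comp_of F u \<union> comp_of F v"
    | w where "w \<in> V" "C = comp_of F w" "comp_of F w \<noteq> comp_of F u" "comp_of F w \<noteq> comp_of F v"
    by (auto simp: comps_def)
  then show "C \<in> comps V (insert {u, v} F)"
  proof cases
    case 1
    then have "C = comp_of (insert {u, v} F) u"
      using comp_of_self[of u F] by (simp add: comp_of_insert)
    then show ?thesis using \<open>u \<in> V\<close> by (simp add: comps_def)
  next
    case 2
    then have "w \<notin> comp_of F u \<union> comp_of F v" using comp_of_eqI by fastforce
    then have "C = comp_of (insert {u, v} F) w" using 2 by (simp add: comp_of_insert)
    then show ?thesis using \<open>w \<in> V\<close> by (simp add: comps_def)
  qed
qed

text \<open>Classes are nonempty and pairwise disjoint, whereas the union meets both. Hence the
  merged class in \<open>comps_insert\<close> is a genuinely new element, as cardinalities, sums and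
  products over the merged family require.\<close>

lemma Un_notin_comps:
  assumes "C \<in> comps V F" "D \<in> comps V F" "C \<noteq> D"
  shows "C \<union> D \<notin> comps V F"
proof
  assume *: "C \<union> D \<in> comps V F"
  have "C \<inter> (C \<union> D) \<noteq> {}" "D \<inter> (C \<union> D) \<noteq> {}"
    using comps_nonempty[OF assms(1)] comps_nonempty[OF assms(2)] by auto
  then have "C = C \<union> D" "D = C \<union> D" using comps_disjoint[OF _ *] assms by blast+
  then show False using assms(3) by simp
qed

lemma card_comps_insert:
  assumes "finite V" "u \<in> V" "v \<in> V" "(u, v) \<notin> (adj F)\<^sup>*"
  shows "Suc (card (comps V (insert {u, v} F))) = card (comps V F)"
proof -
  let ?C = "comp_of F u" and ?D = "comp_of F v"
  have CD: "?C \<in> comps V F" "?D \<in> comps V F" "?C \<noteq> ?D"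
    using assms by (auto simp: comps_def comp_of_eq_iff)
  have fin: "finite (comps V F)" using assms(1) by (simp add: comps_def)
  have "card {?C, ?D} \<le> card (comps V F)" using CD fin by (intro card_mono) auto
  then have "card (comps V F) \<ge> 2" using CD by simp
  moreover have "card (comps V F - {?C, ?D}) = card (comps V F) - 2"
    using CD by (subst card_Diff_subset) auto
  ultimately show ?thesis
    using Un_notin_comps[OF CD] fin by (simp add: comps_insert[OF assms(2,3)])
qed

section \<open>Forests, built edge by edge\<close>

lemma forest_subset: "forest F' \<Longrightarrow> F \<subseteq> F' \<Longrightarrow> forest F"
  unfolding forest_def by (meson Diff_mono adj_rtrancl_mono order_refl subsetD)

text \<open>If an old edge \<open>{x, y}\<close> ceased to be a bridge, the path around it would use
  \<open>{u, v}\<close>. Its two remaining pieces together with \<open>{x, y}\<close> would then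
  join \<open>u\<close> to \<open>v\<close> inside \<open>F\<close>.\<close>

lemma forest_insertI:
  assumes "forest F" and uv: "(u, v) \<notin> (adj F)\<^sup>*"
  shows "forest (insert {u, v} F)"
  unfolding forest_def
proof (intro allI impI notI)
  fix x y
  assume xy: "{x, y} \<in> insert {u, v} F"
    and conn: "(x, y) \<in> (adj (insert {u, v} F - {{x, y}}))\<^sup>*"
  show False
  proof (cases "{x, y} = {u, v}")
    case True
    then have "(x, y) \<in> (adj F)\<^sup>*" using conn by (auto intro: adj_rtrancl_mono[rotated])
    then show False using True uv adj_rtrancl_sym[of x y F] by (auto simp: doubleton_eq_iff)
  next
    case False
    let ?F = "F - {{x, y}}"
    have xyF: "{x, y} \<in> F" using False xy by auto
    have eq: "insert {u, v} F - {{x, y}} = insert {u, v} ?F" using False by auto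
    have "(x, y) \<notin> (adj ?F)\<^sup>*" using assms(1) xyF by (auto simp: forest_def)
    \<comment> \<open>The new edge enters \<open>adj\<close> as two ordered pairs, which yields four
      cases. The last two would join \<open>x\<close> to \<open>y\<close> within \<open>?F\<close>
      and are discarded next.\<close>
    then have "(x, u) \<in> (adj ?F)\<^sup>* \<and> (v, y) \<in> (adj ?F)\<^sup>* \<or> (x, v) \<in> (adj ?F)\<^sup>* \<and> (u, y) \<in> (adj ?F)\<^sup>* \<or>
       (x, u) \<in> (adj ?F)\<^sup>* \<and> (u, y) \<in> (adj ?F)\<^sup>* \<or> (x, v) \<in> (adj ?F)\<^sup>* \<and> (v, y) \<in> (adj ?F)\<^sup>*"
      using conn unfolding eq adj_insert rtrancl_insert by auto
    then have "(x, u) \<in> (adj F)\<^sup>* \<and> (v, y) \<in> (adj F)\<^sup>* \<or> (x, v) \<in> (adj F)\<^sup>* \<and> (u, y) \<in> (adj F)\<^sup>*"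
      using \<open>(x, y) \<notin> (adj ?F)\<^sup>*\<close> by (meson Diff_subset adj_rtrancl_mono rtrancl_trans)
    moreover have "(x, y) \<in> (adj F)\<^sup>*" using xyF by (auto simp: adj_def)
    ultimately show False using uv by (meson adj_rtrancl_sym rtrancl_trans)
  qed
qed

lemma forest_insertD:
  assumes "forest (insert {u, v} F)" "{u, v} \<notin> F"
  shows "(u, v) \<notin> (adj F)\<^sup>*"
proof -
  have "insert {u, v} F - {{u, v}} = F" using assms(2) by auto
  then show ?thesis using assms(1) unfolding forest_def by (metis insertI1)
qed

text \<open>The empty forest has the singletons of \<open>V\<close> as components, and each further
  edge, being a bridge, lowers the number of components by one.\<close>

lemma card_forest:
  assumes "finite F" "forest F" "finite V" "\<And>e. e \<in> F \<Longrightarrow> e \<subseteq> V \<and> card e = 2"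
  shows "card F + card (comps V F) = card V"
  using assms(1,2,4)
proof (induction F rule: finite_induct)
  case empty
  have "comps V {} = (\<lambda>v. {v}) ` V" by (auto simp: comps_def comp_of_def adj_def)
  then show ?case by (simp add: card_image)
next
  case (insert e F)
  obtain u v where e: "e = {u, v}" using insert.prems(2)[of e] by (auto simp: card_2_iff)
  have "(u, v) \<notin> (adj F)\<^sup>*" using forest_insertD[of u v F] insert e by simp
  moreover have "u \<in> V" "v \<in> V" using insert.prems(2)[of e] e by auto
  ultimately have "Suc (card (comps V (insert e F))) = card (comps V F)"
    unfolding e by (intro card_comps_insert[OF \<open>finite V\<close>]) auto
  moreover have "card F + card (comps V F) = card V"
    using insert.prems forest_subset by (intro insert.IH) blast+
  ultimately show ?case using insert.hyps by simp
qed

section \<open>Trees\<close>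

lemma successively_rtrancl:
  "successively (\<lambda>u v. {u, v} \<in> F) vs \<Longrightarrow> vs \<noteq> [] \<Longrightarrow> (hd vs, last vs) \<in> (adj F)\<^sup>*"
proof (induction vs rule: induct_list012)
  case (3 x y zs)
  then have "(x, y) \<in> adj F" by (simp add: adj_def)
  then show ?case using 3 by (auto intro: converse_rtrancl_into_rtrancl)
qed auto

lemma rtrancl_path_successively:
  "rtrancl_path r x xs y \<Longrightarrow> successively r (x # xs) \<and> last (x # xs) = y"
  by (induction rule: rtrancl_path.induct) (auto simp: successively_Cons)

lemma adj_rtrancl_path:
  assumes "(u, v) \<in> (adj F)\<^sup>*"
  obtains vs where "successively (\<lambda>u v. {u, v} \<in> F) (u # vs)" "last (u # vs) = v" "distinct (u # vs)"
proof -
  have "(\<lambda>u v. {u, v} \<in> F)\<^sup>*\<^sup>* u v" using assms by (simp add: adj_def rtrancl_def)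
  then obtain xs where "rtrancl_path (\<lambda>u v. {u, v} \<in> F) u xs v" by (auto simp: rtranclp_eq_rtrancl_path)
  then obtain ys where "rtrancl_path (\<lambda>u v. {u, v} \<in> F) u ys v" "distinct (u # ys)"
    by (rule rtrancl_path_distinct)
  then show ?thesis using that rtrancl_path_successively by fast
qed

lemma successively_subset:
  assumes "successively (\<lambda>u v. {u, v} \<in> F) (u # vs)" "u \<in> V" "\<And>e. e \<in> F \<Longrightarrow> e \<subseteq> V"
  shows "set (u # vs) \<subseteq> V"
  using assms(1,2)
proof (induction vs arbitrary: u)
  case (Cons w ws)
  then have "{u, w} \<in> F" by simp
  then have "w \<in> V" using assms(3) by blast
  then show ?case using Cons by auto
qed simp

text \<open>The closing edge is not a bridge, because the rest of the cycle joins its ends.\<close>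

lemma cycle_imp_not_forest:
  assumes "cycle G vs"
  shows "\<not> forest (edges G)"
proof
  assume fo: "forest (edges G)"
  obtain u w ws where vs: "vs = u # w # ws" and ws: "ws \<noteq> []"
    using assms by (cases vs; cases "tl vs"; cases "tl (tl vs)") (auto simp: cycle_def)
  let ?e = "{u, last ws}"
  have suc: "successively (\<lambda>u v. {u, v} \<in> edges G) vs" and d: "distinct vs"
    and e: "?e \<in> edges G"
    using assms vs ws by (auto simp: cycle_def walk_def insert_commute)
  have "w \<noteq> last ws" using d ws vs by auto
  then have "{u, w} \<noteq> ?e" "u \<noteq> w" using d vs by (auto simp: doubleton_eq_iff)
  then have "(u, w) \<in> adj (edges G - {?e})" using suc vs by (auto simp: adj_def)
  \<comment> \<open>Vertices are distinct, so the edges along \<open>w # ws\<close> avoid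
    \<open>u\<close> and none of them is the closing edge \<open>?e\<close>.\<close>
  moreover have "successively (\<lambda>u v. {u, v} \<in> edges G - {?e}) (w # ws)"
  proof (rule successively_mono[of "\<lambda>u v. {u, v} \<in> edges G"])
    show "successively (\<lambda>u v. {u, v} \<in> edges G) (w # ws)" using suc vs by simp
    show "{x, y} \<in> edges G - {?e}" if "x \<in> set (w # ws)" "y \<in> set (w # ws)" "{x, y} \<in> edges G" for x y
      using that d vs by (auto simp: doubleton_eq_iff)
  qed
  then have "(w, last ws) \<in> (adj (edges G - {?e}))\<^sup>*"
    using successively_rtrancl[of _ "w # ws"] ws by auto
  ultimately have "(u, last ws) \<in> (adj (edges G - {?e}))\<^sup>*" by (rule converse_rtrancl_into_rtrancl)
  then show False using fo e by (auto simp: forest_def)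
qed

text \<open>For the direction not covered by \<open>cycle_imp_not_forest\<close>: an edge that is
  not a bridge forms a cycle with a path of distinct vertices between its ends.\<close>

lemma acyclic_graph_iff_forest:
  assumes "simple_graph G"
  shows "acyclic_graph G \<longleftrightarrow> forest (edges G)"
proof
  assume ac: "acyclic_graph G"
  show "forest (edges G)"
    unfolding forest_def
  proof (intro allI impI notI)
    fix u v
    assume uv: "{u, v} \<in> edges G" and conn: "(u, v) \<in> (adj (edges G - {{u, v}}))\<^sup>*"
    obtain vs where vs: "successively (\<lambda>x y. {x, y} \<in> edges G - {{u, v}}) (u # vs)"
        "last (u # vs) = v" "distinct (u # vs)"
      using adj_rtrancl_path[OF conn] .
    have uvV: "u \<in> verts G" "u \<noteq> v" using uv assms by (auto simp: simple_graph_def)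
    have suc: "successively (\<lambda>x y. {x, y} \<in> edges G) (u # vs)"
      by (rule successively_mono[OF vs(1)]) auto
    have "set (u # vs) \<subseteq> verts G"
      using successively_subset[OF suc uvV(1)] assms by (auto simp: simple_graph_def)
    moreover obtain w ws where w: "vs = w # ws" using vs(2) uvV(2) by (cases vs) auto
    \<comment> \<open>A path with only two vertices would be the edge \<open>{u, v}\<close> itself,
      which was removed.\<close>
    have "ws \<noteq> []" using vs w by auto
    then have "length (u # vs) \<ge> 3" using w by (cases ws) auto
    ultimately have "cycle G (u # vs)"
      using suc vs uv by (auto simp: cycle_def walk_def insert_commute)
    then show False using ac by (auto simp: acyclic_graph_def)
  qed
qed (auto simp: acyclic_graph_def dest: cycle_imp_not_forest)

lemma connected_graph_iff_comps:
  assumes "simple_graph G"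
  shows "connected_graph G \<longleftrightarrow> card (comps (verts G) (edges G)) = 1"
proof
  assume c: "connected_graph G"
  then obtain u where u: "u \<in> verts G" by (auto simp: connected_graph_def)
  have "comp_of (edges G) v = comp_of (edges G) u" if "v \<in> verts G" for v
  proof -
    have "\<exists>vs. walk G vs \<and> hd vs = v \<and> last vs = u"
      using c that u by (simp add: connected_graph_def)
    then have "(v, u) \<in> (adj (edges G))\<^sup>*"
      using successively_rtrancl[of "edges G"] by (auto simp: walk_def)
    then show ?thesis by (simp add: comp_of_eq_iff)
  qed
  then have "comps (verts G) (edges G) = {comp_of (edges G) u}"
    unfolding comps_def using u by blast
  then show "card (comps (verts G) (edges G)) = 1" by simp
next
  assume "card (comps (verts G) (edges G)) = 1"
  then obtain C where C: "comp_of (edges G) ` verts G = {C}" by (auto simp: comps_def card_1_singleton_iff)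
  have "\<exists>vs. walk G vs \<and> hd vs = u \<and> last vs = v" if uv: "u \<in> verts G" "v \<in> verts G" for u v
  proof -
    have "comp_of (edges G) u = comp_of (edges G) v" using C uv by (metis imageI singletonD)
    then have "(u, v) \<in> (adj (edges G))\<^sup>*" by (simp add: comp_of_eq_iff)
    then obtain vs where "successively (\<lambda>x y. {x, y} \<in> edges G) (u # vs)" "last (u # vs) = v"
      by (rule adj_rtrancl_path)
    moreover from this have "set (u # vs) \<subseteq> verts G"
      using successively_subset[OF _ uv(1)] assms by (auto simp: simple_graph_def)
    ultimately show ?thesis by (intro exI[of _ "u # vs"]) (simp add: walk_def)
  qed
  then show "connected_graph G" using C by (auto simp: connected_graph_def)
qed

text \<open>With the vertex set fixed, a spanning tree is determined by its edges. Having exactly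
  one class expresses connectedness, including that \<open>V\<close> is nonempty.\<close>

definition spanning_edge_sets :: "'v set \<Rightarrow> 'v set set \<Rightarrow> 'v set set \<Rightarrow> 'v set set set" where
  "spanning_edge_sets V E F = {T. F \<subseteq> T \<and> T \<subseteq> E \<and> forest T \<and> card (comps V T) = 1}"

lemma num_spanning_trees_containing_eq:
  fixes G :: "'v ugraph"
  assumes "simple_graph G"
  shows "\<tau>\<^bsub>H\<^esub> G = card (spanning_edge_sets (verts G) (edges G) H)"
proof -
  let ?f = "\<lambda>T. \<lparr>verts = verts G, edges = T\<rparr> :: 'v ugraph"
  have sg: "simple_graph (?f T)" if "T \<subseteq> edges G" for T
    using that assms by (auto simp: simple_graph_def)
  have "{T. spanning_tree T G \<and> H \<subseteq> edges T} = ?f ` spanning_edge_sets (verts G) (edges G) H"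
  proof (intro equalityI subsetI)
    fix T :: "'v ugraph" assume T: "T \<in> {T. spanning_tree T G \<and> H \<subseteq> edges T}"
    then have "T = ?f (edges T)" by (auto simp: spanning_tree_def)
    moreover have "edges T \<in> spanning_edge_sets (verts G) (edges G) H"
      using T acyclic_graph_iff_forest[of T] connected_graph_iff_comps[of T]
      by (auto simp: spanning_tree_def tree_def spanning_edge_sets_def)
    ultimately show "T \<in> ?f ` spanning_edge_sets (verts G) (edges G) H" by blast
  next
    fix T :: "'v ugraph" assume "T \<in> ?f ` spanning_edge_sets (verts G) (edges G) H"
    then show "T \<in> {T. spanning_tree T G \<and> H \<subseteq> edges T}"
      using sg acyclic_graph_iff_forest[OF sg] connected_graph_iff_comps[OF sg]
      by (auto simp: spanning_tree_def tree_def spanning_edge_sets_def)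
  qed
  then show ?thesis
    unfolding num_spanning_trees_containing_def by (simp add: card_image inj_on_def)
qed

section \<open>Counting the spanning trees that extend a forest\<close>

text \<open>This is the recurrence for the closed form, with the common factor of all terms removed.
  The indices stand for components, \<open>a i * b j\<close> counts the edges from the
  \<open>A\<close>-side of \<open>i\<close> to the \<open>B\<close>-side of \<open>j\<close>, and
  the bracket comes from \<open>forest_weight_merge\<close>. Each term factors into a function of
  \<open>i\<close> times one of \<open>j\<close>, so the full double sum reduces to single sums,
  evaluated through the formula for \<open>x\<close>; the diagonal is then subtracted.\<close>

lemma bilinear_merge_sum:
  fixes a b :: "'i \<Rightarrow> real" and m n :: real
  assumes "finite P" "m > 0" "n > 0" "sum a P = m" "sum b P = n"
    and x: "\<And>i. i \<in> P \<Longrightarrow> x i = n * a i + m * b i" "\<And>i. i \<in> P \<Longrightarrow> x i > 0"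
  defines "s \<equiv> \<lambda>i. a i * b i / x i"
  defines "S \<equiv> sum s P"
  shows "(\<Sum>i\<in>P. \<Sum>j\<in>P - {i}. a i * b j *
      ((1 / x i + 1 / x j) * (1 - S) + s i / x i + s j / x j - (a i * b j + a j * b i) / (x i * x j)))
    = (real (card P) - 1) * (1 - S)"
proof -
  define t where "t i j = a i * b j *
      ((1 / x i + 1 / x j) * (1 - S) + s i / x i + s j / x j - (a i * b j + a j * b i) / (x i * x j))" for i j
  let ?X = "\<Sum>i\<in>P. a i / x i" and ?Y = "\<Sum>i\<in>P. b i / x i"
    and ?U = "\<Sum>i\<in>P. a i * s i / x i" and ?W = "\<Sum>i\<in>P. b i * s i / x i"
    and ?P = "\<Sum>i\<in>P. a i * a i / x i" and ?Q = "\<Sum>i\<in>P. b i * b i / x i"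
  have t: "t i j = (1 - S) * ((a i / x i) * b j) + (1 - S) * (a i * (b j / x j))
      + (a i * s i / x i) * b j + a i * (b j * s j / x j)
      - (a i * a i / x i) * (b j * b j / x j) - s i * s j" for i j
    unfolding t_def s_def by (simp add: algebra_simps add_divide_distrib diff_divide_distrib)
  have full: "(\<Sum>i\<in>P. \<Sum>j\<in>P. t i j) =
      (1 - S) * (?X * n) + (1 - S) * (m * ?Y) + ?U * n + m * ?W - ?P * ?Q - S * S"
    unfolding t S_def assms(4)[symmetric] assms(5)[symmetric] sum_product
    by (simp only: sum.distrib sum_subtractf sum_distrib_left)
  have nz: "x i \<noteq> 0" if "i \<in> P" for i using x(2)[OF that] by simp
  have "n * ?X + m * ?Y = (\<Sum>i\<in>P. (n * a i + m * b i) / x i)"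
    by (simp add: sum_distrib_left sum.distrib add_divide_distrib)
  also have "\<dots> = (\<Sum>i\<in>P. 1)" using x(1) nz by (intro sum.cong) auto
  finally have XY: "n * ?X + m * ?Y = real (card P)" by simp
  have "n * ?U + m * ?W = (\<Sum>i\<in>P. (n * a i + m * b i) * s i / x i)"
    by (simp add: sum_distrib_left sum.distrib add_divide_distrib algebra_simps)
  also have "\<dots> = S" unfolding S_def using x(1) nz by (intro sum.cong) auto
  finally have UW: "n * ?U + m * ?W = S" .
  \<comment> \<open>Factoring \<open>a i\<close> out leaves \<open>x i / x i\<close>, so the sum is
    \<open>m\<close>; this determines \<open>?P\<close>, and \<open>?Q\<close> follows
    symmetrically.\<close>
  have "n * ?P + m * S = (\<Sum>i\<in>P. a i * (n * a i + m * b i) / x i)"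
    unfolding S_def s_def by (simp add: sum_distrib_left sum.distrib add_divide_distrib algebra_simps)
  also have "\<dots> = sum a P" using x(1) nz by (intro sum.cong) auto
  finally have P: "?P = m * (1 - S) / n" using assms by (simp add: field_simps)
  have "m * ?Q + n * S = (\<Sum>i\<in>P. b i * (n * a i + m * b i) / x i)"
    unfolding S_def s_def by (simp add: sum_distrib_left sum.distrib add_divide_distrib algebra_simps)
  also have "\<dots> = sum b P" using x(1) nz by (intro sum.cong) auto
  finally have Q: "?Q = n * (1 - S) / m" using assms by (simp add: field_simps)
  have PQ: "?P * ?Q = (1 - S) * (1 - S)" unfolding P Q using assms by simp
  \<comment> \<open>On the diagonal the two terms with \<open>s\<close> cancel against the last term
    of the bracket.\<close>
  have "t i i = 2 * (1 - S) * s i" if "i \<in> P" for i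
    unfolding t_def s_def using nz[OF that] by (simp add: field_simps)
  then have diag: "(\<Sum>i\<in>P. t i i) = 2 * (1 - S) * S"
    unfolding S_def by (simp add: sum_distrib_left)
  have "(\<Sum>i\<in>P. \<Sum>j\<in>P - {i}. t i j) = (\<Sum>i\<in>P. (\<Sum>j\<in>P. t i j) - t i i)"
    using assms(1) by (intro sum.cong) (auto simp: sum_diff1)
  also have "\<dots> = (1 - S) * (n * ?X + m * ?Y) + (n * ?U + m * ?W) - ?P * ?Q - S * S - 2 * (1 - S) * S"
    by (simp only: sum_subtractf full diag) (simp add: algebra_simps)
  \<comment> \<open>The quadratic terms combine to the square of \<open>(1 - S) + S\<close>, that
    is, to 1.\<close>
  also have "\<dots> = (real (card P) - 1) * (1 - S)"
    unfolding XY UW PQ by (simp add: algebra_simps)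
  finally show ?thesis unfolding t_def .
qed

text \<open>For \<open>C\<close> inside \<open>A \<union> B\<close> this is the sum of the degrees
  of the vertices of \<open>C\<close> in the complete bipartite graph.\<close>

definition comp_weight :: "'v set \<Rightarrow> 'v set \<Rightarrow> 'v set \<Rightarrow> real" where
  "comp_weight A B C = real (card B) * real (card (C \<inter> A)) + real (card A) * real (card (C \<inter> B))"

definition forest_weight :: "'v set \<Rightarrow> 'v set \<Rightarrow> 'v set set \<Rightarrow> real" where
  "forest_weight A B P = (\<Prod>C\<in>P. comp_weight A B C) *
     (1 - (\<Sum>C\<in>P. real (card (C \<inter> A)) * real (card (C \<inter> B)) / comp_weight A B C))
     / (real (card A) * real (card B))"

text \<open>The merged weight is expressed through \<open>S\<close> and the product of the unmerged
  family, so that these become constants when summing over all pairs \<open>C\<close>,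
  \<open>D\<close>. The reason is that \<open>a\<close>, \<open>b\<close> and \<open>x\<close> are
  additive on disjoint unions.\<close>

lemma forest_weight_merge:
  fixes A B :: "'v set"
  defines "x \<equiv> comp_weight A B"
    and "a \<equiv> \<lambda>C. real (card (C \<inter> A))" and "b \<equiv> \<lambda>C. real (card (C \<inter> B))"
  assumes "finite P" "C \<in> P" "D \<in> P" "C \<noteq> D" "C \<inter> D = {}" "C \<union> D \<notin> P" "finite A" "finite B"
    and pos: "x C > 0" "x D > 0"
  defines "S \<equiv> \<Sum>C\<in>P. a C * b C / x C"
  shows "forest_weight A B (insert (C \<union> D) (P - {C, D})) =
    prod x P / (real (card A) * real (card B)) *
      ((1 / x C + 1 / x D) * (1 - S) + a C * b C / x C / x C + a D * b D / x D / x D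
        - (a C * b D + a D * b C) / (x C * x D))"
proof -
  have card_Un: "real (card ((C \<union> D) \<inter> Z)) = real (card (C \<inter> Z)) + real (card (D \<inter> Z))" if "finite Z" for Z
    using that assms(8) by (subst Int_Un_distrib2, subst card_Un_disjoint) auto
  have aCD: "a (C \<union> D) = a C + a D" and bCD: "b (C \<union> D) = b C + b D"
    unfolding a_def b_def using card_Un assms by auto
  have xCD: "x (C \<union> D) = x C + x D"
    unfolding x_def comp_weight_def using aCD bCD by (simp add: a_def b_def algebra_simps)
  have P: "P = insert C (insert D (P - {C, D}))" using assms by auto
  have prod: "prod x P = x C * x D * prod x (P - {C, D})"
    by (subst P) (use assms in simp)
  have S: "S = a C * b C / x C + a D * b D / x D + (\<Sum>C\<in>P - {C, D}. a C * b C / x C)"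
    unfolding S_def by (subst P) (use assms in simp)
  have "forest_weight A B (insert (C \<union> D) (P - {C, D})) = x (C \<union> D) * prod x (P - {C, D}) *
     (1 - (a (C \<union> D) * b (C \<union> D) / x (C \<union> D) + (\<Sum>C\<in>P - {C, D}. a C * b C / x C)))
     / (real (card A) * real (card B))"
    using assms by (simp add: forest_weight_def)
  \<comment> \<open>The factor \<open>x (C \<union> D)\<close> of the product clears the only
    denominator belonging to the merged component.\<close>
  also have "\<dots> = prod x (P - {C, D}) / (real (card A) * real (card B)) *
     ((x C + x D) * (1 - (S - a C * b C / x C - a D * b D / x D)) - (a C + a D) * (b C + b D))"
    unfolding aCD bCD xCD S using pos by (simp add: divide_simps) (simp add: algebra_simps)
  also have "\<dots> = prod x (P - {C, D}) / (real (card A) * real (card B)) * (x C * x D *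
      ((1 / x C + 1 / x D) * (1 - S) + a C * b C / x C / x C + a D * b D / x D / x D
        - (a C * b D + a D * b C) / (x C * x D)))"
    using pos by (intro arg_cong2[where f="(*)"] refl) (simp add: divide_simps, simp add: algebra_simps)
  finally show ?thesis unfolding prod by (simp add: mult_ac)
qed

section \<open>Sums grouped by component and the recurrence for the counts\<close>

lemma sum_over_comps:
  fixes f :: "'v set \<Rightarrow> real"
  assumes "finite V" "A \<subseteq> V"
  shows "(\<Sum>a\<in>A. f (comp_of F a)) = (\<Sum>C\<in>comps V F. real (card (C \<inter> A)) * f C)"
proof -
  have fin: "finite A" using assms finite_subset by auto
  have "(\<Sum>a\<in>A. f (comp_of F a)) = (\<Sum>C\<in>comps V F. \<Sum>a\<in>{a \<in> A. comp_of F a = C}. f (comp_of F a))"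
    using assms fin by (intro sum.group[symmetric]) (auto simp: comps_def)
  also have "\<dots> = (\<Sum>C\<in>comps V F. real (card (C \<inter> A)) * f C)"
  proof (rule sum.cong)
    fix C assume C: "C \<in> comps V F"
    then have eq: "{a \<in> A. comp_of F a = C} = C \<inter> A"
      using comp_of_self[of _ F] comp_of_eqI[of _ F] by (auto simp: comps_def)
    have "(\<Sum>a\<in>{a \<in> A. comp_of F a = C}. f (comp_of F a)) = (\<Sum>a\<in>{a \<in> A. comp_of F a = C}. f C)"
      by (intro sum.cong) auto
    then show "(\<Sum>a\<in>{a \<in> A. comp_of F a = C}. f (comp_of F a)) = real (card (C \<inter> A)) * f C"
      by (simp add: eq)
  qed simp
  finally show ?thesis .
qed

text \<open>Both sides count pairs of a spanning tree \<open>T\<close> containing \<open>F\<close>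
  and an edge of \<open>T\<close> outside \<open>F\<close>. By \<open>card_forest\<close>, every
  such \<open>T\<close> has the same number of these edges.\<close>

lemma spanning_edge_sets_double_count:
  assumes "finite V" and E: "\<And>e. e \<in> E \<Longrightarrow> e \<subseteq> V \<and> card e = 2" and F: "F \<subseteq> E" "forest F"
  shows "(card (comps V F) - 1) * card (spanning_edge_sets V E F) =
    (\<Sum>e\<in>E - F. card (spanning_edge_sets V E (insert e F)))"
proof -
  let ?N = "spanning_edge_sets V E F"
  have finE: "finite E" using E assms(1) by (intro finite_subset[of E "Pow V"]) auto
  have finN: "finite ?N"
    using finE by (intro finite_subset[of ?N "Pow E"]) (auto simp: spanning_edge_sets_def)
  have cF: "card F + card (comps V F) = card V"
    using F E finE assms(1) by (intro card_forest) (auto intro: finite_subset)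
  have cT: "card ((E - F) \<inter> T) = card (comps V F) - 1" if "T \<in> ?N" for T
  proof -
    have T: "F \<subseteq> T" "T \<subseteq> E" "forest T" "card (comps V T) = 1"
      using that by (auto simp: spanning_edge_sets_def)
    have "finite T" using T finE finite_subset by auto
    have "card T + card (comps V T) = card V"
      using T E \<open>finite T\<close> assms(1) by (intro card_forest) auto
    moreover have "(E - F) \<inter> T = T - F" using T by auto
    ultimately show ?thesis
      using T cF \<open>finite T\<close> by (simp add: card_Diff_subset finite_subset)
  qed
  have "(card (comps V F) - 1) * card ?N = (\<Sum>T\<in>?N. card ((E - F) \<inter> T))"
    using cT by simp
  also have "\<dots> = (\<Sum>T\<in>?N. \<Sum>e\<in>E - F. of_bool (e \<in> T))"
    using finE by (intro sum.cong) (auto simp: of_bool_def sum.If_cases)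
  also have "\<dots> = (\<Sum>e\<in>E - F. \<Sum>T\<in>?N. of_bool (e \<in> T))" by (rule sum.swap)
  also have "\<dots> = (\<Sum>e\<in>E - F. card (spanning_edge_sets V E (insert e F)))"
  proof (rule sum.cong)
    fix e assume "e \<in> E - F"
    have "?N \<inter> {T. e \<in> T} = spanning_edge_sets V E (insert e F)"
      by (auto simp: spanning_edge_sets_def)
    then show "(\<Sum>T\<in>?N. of_bool (e \<in> T)) = card (spanning_edge_sets V E (insert e F))"
      using finN by (simp add: of_bool_def sum.If_cases)
  qed simp
  finally show ?thesis .
qed

theorem card_spanning_edge_sets_complete_bipartite:
  fixes A B :: "'v set"
  assumes fin: "finite A" "finite B" and ne: "A \<noteq> {}" "B \<noteq> {}" and AB: "A \<inter> B = {}"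
    and "F \<subseteq> {{a, b} | a b. a \<in> A \<and> b \<in> B}" "forest F"
  shows "real (card (spanning_edge_sets (A \<union> B) {{a, b} | a b. a \<in> A \<and> b \<in> B} F)) =
    forest_weight A B (comps (A \<union> B) F)"
  using assms(6,7)
proof (induction "card (comps (A \<union> B) F)" arbitrary: F rule: less_induct)
  case less
  let ?E = "{{a, b} | a b. a \<in> A \<and> b \<in> B}" and ?V = "A \<union> B" and ?P = "comps (A \<union> B) F"
  let ?m = "real (card A)" and ?n = "real (card B)"
    and ?N = "\<lambda>F. card (spanning_edge_sets (A \<union> B) {{a, b} | a b. a \<in> A \<and> b \<in> B} F)"
  define a where "a C = real (card (C \<inter> A))" for C
  define b where "b C = real (card (C \<inter> B))" for C
  define x where "x = comp_weight A B"
  define S where "S = (\<Sum>C\<in>?P. a C * b C / x C)"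
  have m: "?m > 0" and n: "?n > 0" using fin ne by (auto simp: card_gt_0_iff)
  have finV: "finite ?V" using fin by simp
  have E: "e \<subseteq> ?V \<and> card e = 2" if "e \<in> ?E" for e
  proof -
    obtain u v where uv: "e = {u, v}" "u \<in> A" "v \<in> B" using \<open>e \<in> ?E\<close> by auto
    then have "u \<noteq> v" using AB by auto
    then show ?thesis using uv by auto
  qed
  have FV: "e \<subseteq> ?V" if "e \<in> F" for e using that less.prems E by blast
  have finF: "finite F"
    using FV finV by (intro finite_subset[of F "Pow ?V"]) auto
  have cF: "card F + card ?P = card ?V"
    using less.prems E finV finF by (intro card_forest) auto
  have finP: "finite ?P" using finV by (simp add: comps_def)
  have Pne: "?P \<noteq> {}" using ne by (auto simp: comps_def)
  have UP: "\<Union> ?P = ?V" using FV by (rule Union_comps)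
  have suma: "sum a ?P = ?m" and sumb: "sum b ?P = ?n"
    using sum_over_comps[OF finV, of A "\<lambda>_. 1" F] sum_over_comps[OF finV, of B "\<lambda>_. 1" F]
    by (auto simp: a_def b_def)
  have x: "x C = ?n * a C + ?m * b C" for C by (simp add: x_def comp_weight_def a_def b_def)
  have xpos: "x C > 0" if "C \<in> ?P" for C
  proof -
    have "C \<noteq> {}" "C \<subseteq> ?V" using comps_nonempty[OF that] UP that by auto
    then have "C \<inter> A \<noteq> {} \<or> C \<inter> B \<noteq> {}" by blast
    then have "a C > 0 \<or> b C > 0" using fin by (auto simp: a_def b_def card_gt_0_iff)
    moreover have "a C \<ge> 0" "b C \<ge> 0" by (auto simp: a_def b_def)
    ultimately show ?thesis
      unfolding x using m n by (auto intro: add_pos_nonneg add_nonneg_pos)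
  qed
  show ?case
  proof (cases "card ?P = 1")
    \<comment> \<open>Base case: \<open>F\<close> already connects everything, and any tree above it
      has equally many edges, so it equals \<open>F\<close>.\<close>
    case True
    then obtain C where "?P = {C}" by (auto simp: card_1_singleton_iff)
    then have P: "?P = {?V}" using UP by simp
    have "T = F" if "T \<in> spanning_edge_sets ?V ?E F" for T
    proof -
      have T: "F \<subseteq> T" "T \<subseteq> ?E" "forest T" "card (comps ?V T) = 1"
        using that by (auto simp: spanning_edge_sets_def)
      have "finite T" using T E finV by (intro finite_subset[of T "Pow ?V"]) blast+
      then have "card T + card (comps ?V T) = card ?V"
        using card_forest[OF _ T(3) finV E[OF subsetD[OF T(2)]]] by simp
      then have "card T = card F" using T cF True by simp
      then show ?thesis using card_subset_eq[OF \<open>finite T\<close> T(1)] by simp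
    qed
    moreover have "F \<in> spanning_edge_sets ?V ?E F"
      using less.prems True by (auto simp: spanning_edge_sets_def)
    ultimately have "spanning_edge_sets ?V ?E F = {F}" by blast
    then have "?N F = 1" by simp
    \<comment> \<open>The single component has weight \<open>2 * ?m * ?n\<close>, and the bracket in
      \<open>forest_weight\<close> is 1/2.\<close>
    moreover have "forest_weight A B ?P = 1"
      unfolding P using m n
      by (simp add: forest_weight_def comp_weight_def Int_absorb1 field_simps)
    ultimately show ?thesis by simp
  next
    case False
    \<comment> \<open>The predicted count after adding an edge between \<open>C\<close> and
      \<open>D\<close>, which depends only on these two components. It is 0 for
      \<open>C = D\<close>, where a new edge closes a cycle and edges of \<open>F\<close> are not to
      be counted.\<close>
    define h where "h C D = (if C = D then 0 else prod x ?P / (?m * ?n) *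
      ((1 / x C + 1 / x D) * (1 - S) + a C * b C / x C / x C + a D * b D / x D / x D
        - (a C * b D + a D * b C) / (x C * x D)))" for C D
    have step: "real (if {u, v} \<in> F then 0 else ?N (insert {u, v} F)) = h (comp_of F u) (comp_of F v)"
      if uv: "u \<in> A" "v \<in> B" for u v
    proof (cases "(u, v) \<in> (adj F)\<^sup>*")
      case True
      have "spanning_edge_sets ?V ?E (insert {u, v} F) = {}" if "{u, v} \<notin> F"
        using True forest_insertD[OF _ that] forest_subset
        unfolding spanning_edge_sets_def by blast
      then show ?thesis using True by (simp add: h_def comp_of_eq_iff)
    next
      case False
      let ?C = "comp_of F u" and ?D = "comp_of F v"
      have nF: "{u, v} \<notin> F" using False by (auto simp: adj_def)
      have CD: "?C \<in> ?P" "?D \<in> ?P" "?C \<noteq> ?D" using uv False by (auto simp: comps_def comp_of_eq_iff)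
      have "Suc (card (comps ?V (insert {u, v} F))) = card ?P"
        using uv False finV by (intro card_comps_insert) auto
      then have "real (?N (insert {u, v} F)) = forest_weight A B (comps ?V (insert {u, v} F))"
        using less.prems uv False by (intro less.hyps forest_insertI) auto
      also have "comps ?V (insert {u, v} F) = insert (?C \<union> ?D) (?P - {?C, ?D})"
        using uv by (intro comps_insert) auto
      also have "forest_weight A B \<dots> = h ?C ?D"
        unfolding h_def S_def x_def a_def b_def
        using forest_weight_merge[OF finP CD comps_disjoint[OF CD] Un_notin_comps[OF CD] fin]
          xpos[OF CD(1)] xpos[OF CD(2)] CD(3) by (simp add: x_def)
      finally show ?thesis using nF by simp
    qed
    have inj: "inj_on (\<lambda>(u, v). {u, v}) (A \<times> B)"
      using AB by (auto simp: inj_on_def doubleton_eq_iff)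
    have Eimg: "?E = (\<lambda>(u, v). {u, v}) ` (A \<times> B)" by auto
    have finE: "finite ?E" unfolding Eimg using fin by blast
    have "(real (card ?P) - 1) * real (?N F) = real ((card ?P - 1) * ?N F)"
      using Pne finP by (simp add: of_nat_diff Suc_le_eq card_gt_0_iff)
    also have "\<dots> = (\<Sum>e\<in>?E - F. real (?N (insert e F)))"
      using spanning_edge_sets_double_count[OF finV E less.prems] by simp
    \<comment> \<open>Edges of \<open>F\<close> are put back with value 0, so that the index set
      becomes the product \<open>A \<times> B\<close>.\<close>
    also have "\<dots> = (\<Sum>e\<in>?E. real (if e \<in> F then 0 else ?N (insert e F)))"
      using finE by (intro sum.mono_neutral_cong_left) auto
    also have "\<dots> = (\<Sum>(u, v)\<in>A \<times> B. real (if {u, v} \<in> F then 0 else ?N (insert {u, v} F)))"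
      unfolding Eimg by (subst sum.reindex[OF inj]) (simp add: case_prod_unfold)
    also have "\<dots> = (\<Sum>(u, v)\<in>A \<times> B. h (comp_of F u) (comp_of F v))"
      using step by (intro sum.cong) auto
    also have "\<dots> = (\<Sum>u\<in>A. \<Sum>v\<in>B. h (comp_of F u) (comp_of F v))"
      by (simp add: sum.cartesian_product)
    \<comment> \<open>Endpoints are grouped by component, first in \<open>B\<close> and then in
      \<open>A\<close>; the multiplicities are \<open>b D\<close> and \<open>a C\<close>.\<close>
    also have "\<dots> = (\<Sum>u\<in>A. \<Sum>D\<in>?P. b D * h (comp_of F u) D)"
      unfolding b_def by (intro sum.cong refl sum_over_comps[OF finV]) auto
    also have "\<dots> = (\<Sum>C\<in>?P. a C * (\<Sum>D\<in>?P. b D * h C D))"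
      unfolding a_def by (intro sum_over_comps[OF finV]) auto
    also have "\<dots> = (\<Sum>C\<in>?P. \<Sum>D\<in>?P - {C}. prod x ?P / (?m * ?n) * (a C * b D *
      ((1 / x C + 1 / x D) * (1 - S) + a C * b C / x C / x C + a D * b D / x D / x D
        - (a C * b D + a D * b C) / (x C * x D))))"
      unfolding sum_distrib_left
      by (intro sum.cong refl sum.mono_neutral_cong_right) (use finP in \<open>auto simp: h_def\<close>)
    also have "\<dots> = prod x ?P / (?m * ?n) * ((real (card ?P) - 1) * (1 - S))"
      using bilinear_merge_sum[OF finP m n suma sumb x xpos]
      by (simp only: sum_distrib_left[symmetric] S_def)
    finally have "(real (card ?P) - 1) * real (?N F) = (real (card ?P) - 1) * forest_weight A B ?P"
      by (simp add: forest_weight_def S_def x_def a_def b_def)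
    \<comment> \<open>With more than one component the common factor is nonzero and cancels.\<close>
    then show ?thesis using False by simp
  qed
qed

section \<open>Matchings\<close>

text \<open>Consecutive edges of a walk share a vertex, so in a matching they coincide and the walk
  only goes back and forth along one edge.\<close>

lemma matching_adj_rtrancl:
  assumes "pairwise disjnt M"
  shows "(u, v) \<in> (adj M)\<^sup>* \<longleftrightarrow> u = v \<or> {u, v} \<in> M"
proof
  assume "(u, v) \<in> (adj M)\<^sup>*"
  then show "u = v \<or> {u, v} \<in> M"
  proof (induction rule: rtrancl_induct)
    case (step y z)
    then have "{y, z} \<in> M" by (simp add: adj_def)
    then have "{u, y} = {y, z}" if "{u, y} \<in> M"
      using pairwiseD[OF assms that, of "{y, z}"] by (auto simp: disjnt_def)
    then show ?case using step \<open>{y, z} \<in> M\<close> by (auto simp: doubleton_eq_iff)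
  qed simp
qed (auto simp: adj_def)

lemma forest_matching:
  assumes "pairwise disjnt M" "\<And>e. e \<in> M \<Longrightarrow> card e = 2"
  shows "forest M"
  unfolding forest_def
proof (intro allI impI notI)
  fix u v assume uv: "{u, v} \<in> M" and "(u, v) \<in> (adj (M - {{u, v}}))\<^sup>*"
  moreover have "pairwise disjnt (M - {{u, v}})" using assms(1) by (rule pairwise_subset) auto
  ultimately have "u = v" using matching_adj_rtrancl[of "M - {{u, v}}" u v] by simp
  then show False using assms(2)[OF uv] by simp
qed

lemma comps_matching:
  assumes "pairwise disjnt M" "\<And>e. e \<in> M \<Longrightarrow> e \<subseteq> V \<and> card e = 2"
  shows "comps V M = M \<union> (\<lambda>v. {v}) ` (V - \<Union> M)"
proof -
  have *: "comp_of M u = e" if eu: "e \<in> M" "u \<in> e" for e u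
  proof -
    obtain v where e: "e = {u, v}" using assms(2)[OF eu(1)] eu(2) by (auto simp: card_2_iff)
    have uniq: "f = e" if "f \<in> M" "u \<in> f" for f
      using assms(1) that \<open>e \<in> M\<close> \<open>u \<in> e\<close> unfolding pairwise_def disjnt_def by blast
    have "w \<in> comp_of M u \<longleftrightarrow> w \<in> e" for w
      using uniq[of "{u, w}"] e \<open>e \<in> M\<close>
      by (auto simp: comp_of_def matching_adj_rtrancl[OF assms(1)] doubleton_eq_iff)
    then show ?thesis by blast
  qed
  have **: "comp_of M u = {u}" if "u \<notin> \<Union> M" for u
    using that by (auto simp: comp_of_def matching_adj_rtrancl[OF assms(1)])
  show ?thesis
  proof (intro equalityI subsetI)
    fix C assume "C \<in> comps V M"
    then obtain u where "u \<in> V" "C = comp_of M u" by (auto simp: comps_def)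
    then show "C \<in> M \<union> (\<lambda>v. {v}) ` (V - \<Union> M)"
      using *[of _ u] **[of u] by (cases "u \<in> \<Union> M") auto
  next
    fix C assume "C \<in> M \<union> (\<lambda>v. {v}) ` (V - \<Union> M)"
    then show "C \<in> comps V M"
    proof
      assume C: "C \<in> M"
      then obtain u where "u \<in> C" using assms(2)[OF C] by fastforce
      then show ?thesis using *[OF C] assms(2)[OF C] by (auto simp: comps_def)
    next
      assume "C \<in> (\<lambda>v. {v}) ` (V - \<Union> M)"
      then show ?thesis using ** by (auto simp: comps_def)
    qed
  qed
qed

text \<open>The traces of the edges on \<open>A\<close> are disjoint singletons. Applied to each
  side in turn; the second conclusion ensures that the natural-number subtraction is not
  truncated.\<close>

lemma card_vertices_outside_matching:
  assumes "finite A" "finite M" "pairwise disjnt M" "\<And>e. e \<in> M \<Longrightarrow> card (e \<inter> A) = 1"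
  shows "card (A - \<Union> M) = card A - card M" and "card M \<le> card A"
proof -
  have eq: "A \<inter> \<Union> M = (\<Union>e\<in>M. e \<inter> A)" by auto
  have "card (A \<inter> \<Union> M) = (\<Sum>e\<in>M. card (e \<inter> A))"
    unfolding eq using assms by (intro card_UN_disjoint) (auto simp: pairwise_def disjnt_def)
  then have c: "card (A \<inter> \<Union> M) = card M" using assms(4) by simp
  have "card (A - A \<inter> \<Union> M) = card A - card (A \<inter> \<Union> M)"
    using assms(1) by (intro card_Diff_subset) auto
  then show "card (A - \<Union> M) = card A - card M" using c by (simp add: Diff_Int)
  have "card (A \<inter> \<Union> M) \<le> card A" using assms(1) by (intro card_mono) auto
  then show "card M \<le> card A" using c by simp
qed

text \<open>Integer powers are used because exponents can be -1 or smaller, for instance when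
  \<open>k = 0\<close> or \<open>k = n\<close>.\<close>

theorem theorem1p3:
  fixes m n k :: nat and G :: "'v ugraph" and M :: "'v set set"
  assumes "m \<ge> 1" and "n \<ge> 1"
    and "complete_bipartite m n G"
    and "matching G M" and "card M = k"
  shows "real (\<tau>\<^bsub>M\<^esub> G) =
    (real m + real n) powi (int k - 1) * (real m + real n - real k)
      * real m powi (int n - int k - 1) * real n powi (int m - int k - 1)"
proof -
  obtain A B where fin: "finite A" "finite B" and AB: "A \<inter> B = {}" and card: "card A = m" "card B = n"
    and V: "verts G = A \<union> B" and E: "edges G = {{a, b} | a b. a \<in> A \<and> b \<in> B}"
    using assms(3) by (auto simp: complete_bipartite_def)
  have M: "M \<subseteq> edges G" "pairwise disjnt M" using assms(4) by (auto simp: matching_def)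
  have edge: "e \<subseteq> A \<union> B \<and> card e = 2 \<and> card (e \<inter> A) = 1 \<and> card (e \<inter> B) = 1" if e: "e \<in> edges G" for e
  proof -
    obtain u v where uv: "e = {u, v}" "u \<in> A" "v \<in> B" using e E by auto
    then have "e \<inter> A = {u}" "e \<inter> B = {v}" "u \<noteq> v" using AB by auto
    then show ?thesis using uv by auto
  qed
  have "simple_graph G" using edge fin V by (auto simp: simple_graph_def)
  have finM: "finite M" using M edge fin by (intro finite_subset[of M "Pow (A \<union> B)"]) auto
  have "A \<noteq> {}" "B \<noteq> {}" using card assms(1,2) by auto
  have edgeM: "e \<subseteq> A \<union> B \<and> card e = 2" if "e \<in> M" for e using that M edge by blast
  have "forest M" using M edgeM by (intro forest_matching) auto
  then have "real (\<tau>\<^bsub>M\<^esub> G) = forest_weight A B (comps (A \<union> B) M)"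
    using card_spanning_edge_sets_complete_bipartite[OF fin \<open>A \<noteq> {}\<close> \<open>B \<noteq> {}\<close> AB] M
    by (simp add: num_spanning_trees_containing_eq[OF \<open>simple_graph G\<close>] V E)
  define SA where "SA = (\<lambda>v. {v}) ` (A - \<Union> M)"
  define SB where "SB = (\<lambda>v. {v}) ` (B - \<Union> M)"
  have P: "comps (A \<union> B) M = M \<union> (SA \<union> SB)"
    using comps_matching[OF M(2) edgeM] by (auto simp: SA_def SB_def)
  have cA: "card SA = m - k" "k \<le> m" and cB: "card SB = n - k" "k \<le> n"
    using card_vertices_outside_matching[OF fin(1) finM M(2)]
      card_vertices_outside_matching[OF fin(2) finM M(2)] edge M card assms(5)
    by (auto simp: SA_def SB_def card_image)
  have wM: "card (C \<inter> A) = 1 \<and> card (C \<inter> B) = 1" if "C \<in> M" for C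
    using that edge M by blast
  have wA: "card (C \<inter> A) = 1 \<and> card (C \<inter> B) = 0" if "C \<in> SA" for C
    using that AB by (auto simp: SA_def)
  have wB: "card (C \<inter> A) = 0 \<and> card (C \<inter> B) = 1" if "C \<in> SB" for C
    using that AB by (auto simp: SB_def)
  \<comment> \<open>The three families have different pairs of intersection sizes with
    \<open>A\<close> and \<open>B\<close>: (1,1), (1,0) and (0,1).\<close>
  have disj: "M \<inter> (SA \<union> SB) = {}" "SA \<inter> SB = {}"
    using wM wA wB by fastforce+
  have finS: "finite SA" "finite SB" using fin by (auto simp: SA_def SB_def)
  have split: "(\<Prod>C\<in>M \<union> (SA \<union> SB). f C) = (\<Prod>C\<in>M. f C) * ((\<Prod>C\<in>SA. f C) * (\<Prod>C\<in>SB. f C))"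
    "(\<Sum>C\<in>M \<union> (SA \<union> SB). f C) = (\<Sum>C\<in>M. f C) + ((\<Sum>C\<in>SA. f C) + (\<Sum>C\<in>SB. f C))" for f :: "'v set \<Rightarrow> real"
    using disj finM finS by (simp_all add: prod.union_disjoint sum.union_disjoint)
  have "(\<Prod>C\<in>M \<union> (SA \<union> SB). comp_weight A B C) = (real n + real m) ^ k * (real n ^ (m - k) * real m ^ (n - k))"
    unfolding split using wM wA wB cA cB assms(5) by (simp add: comp_weight_def card)
  \<comment> \<open>Single vertices contribute 0, since they miss one side; each of the
    \<open>k\<close> matching edges contributes the reciprocal of \<open>m + n\<close>.\<close>
  moreover have "(\<Sum>C\<in>M \<union> (SA \<union> SB). real (card (C \<inter> A)) * real (card (C \<inter> B)) / comp_weight A B C)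
      = real k / (real n + real m)"
    unfolding split using wM wA wB cA cB assms(5) by (simp add: comp_weight_def card)
  ultimately have count: "real (\<tau>\<^bsub>M\<^esub> G) = (real n + real m) ^ k * (real n ^ (m - k) * real m ^ (n - k))
      * (1 - real k / (real n + real m)) / (real m * real n)"
    using \<open>real (\<tau>\<^bsub>M\<^esub> G) = _\<close> by (simp add: P forest_weight_def card)
  \<comment> \<open>The -1 in each exponent becomes a division; the remaining exponents are natural
    numbers because \<open>k \<le> m\<close> and \<open>k \<le> n\<close>.\<close>
  have p1: "(real m + real n) powi (int k - 1) = (real m + real n) ^ k / (real m + real n)"
    using assms(1) by (simp add: power_int_diff)
  have p2: "real m powi (int n - int k - 1) = real m ^ (n - k) / real m"
    using assms(1) cB(2) by (simp add: power_int_diff flip: of_nat_diff)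
  have p3: "real n powi (int m - int k - 1) = real n ^ (m - k) / real n"
    using assms(2) cA(2) by (simp add: power_int_diff flip: of_nat_diff)
  have "real m + real n \<noteq> 0" "real m \<noteq> 0" "real n \<noteq> 0" using assms(1,2) by auto
  then show ?thesis
    unfolding p1 p2 p3 count by (simp add: add.commute[of "real n"] divide_simps)
qed

end
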